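(* For every integer $m\ge 3$, $\gamma_{rdR}(C_3\times C_m)=2m$.
   Context: Graphs are finite and simple. A restrained double Roman dominating function (RDRD-function) of a graph $G$ is a function $f:V(G)\to\{0,1,2,3\}$ such that: (i) if $f(v)=0$, then $v$ has at least two neighbours assigned 2 under $f$ or at least one neighbour assigned 3; (ii) if $f(v)=1$, then $v$ has a neighbour $u$ with $f(u)\ge 2$; (iii) the subgraph of $G$ induced by the vertices assigned 0 contains no isolated vertex. The weight of $f$ is $\sum_{v\in V(G)}f(v)$, and $\gamma_{rdR}(G)$ is the minimum weight of an RDRD-function of $G$. $C_k$ is the cycle on $k$ vertices. The cardinal (direct) product $G\times H$ has vertex set $V(G)\times V(H)$, with $(u,v)(u',v')$ an edge iff $uu'\in E(G)$ and $vv'\in E(H)$. *)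

theory Defs
  imports "Graph_Theory.Graph_Theory"
begin

text \<open>
  Finite simple graphs are the symmetric, loop-free, finite digraphs without parallel arcs of
  \<^locale>\<open>graph\<close> (resp. \<^locale>\<open>pair_graph\<close>); an undirected edge is the pair of opposite arcs.
  Hence the neighbours of \<open>v\<close> in \<open>G\<close> are the \<open>u\<close> with \<open>v \<rightarrow>\<^bsub>G\<^esub> u\<close>.
\<close>

definition neighbours :: "('a, 'b) pre_digraph \<Rightarrow> 'a \<Rightarrow> 'a set" where
  "neighbours G v = {u \<in> verts G. v \<rightarrow>\<^bsub>G\<^esub> u}"

definition isolated :: "('a, 'b) pre_digraph \<Rightarrow> 'a \<Rightarrow> bool" where
  "isolated G v \<longleftrightarrow> v \<in> verts G \<and> neighbours G v = {}"

text \<open>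
  Labellings are total functions on the vertex type; only their values on \<open>verts G\<close> matter.
\<close>

definition rdrd_function :: "('a, 'b) pre_digraph \<Rightarrow> ('a \<Rightarrow> nat) \<Rightarrow> bool" where
  "rdrd_function G f \<longleftrightarrow>
     (\<forall>v \<in> verts G. f v \<in> {0, 1, 2, 3}) \<and>
     (\<forall>v \<in> verts G. f v = 0 \<longrightarrow>
        card {u \<in> neighbours G v. f u = 2} \<ge> 2 \<or> (\<exists>u \<in> neighbours G v. f u = 3)) \<and>
     (\<forall>v \<in> verts G. f v = 1 \<longrightarrow> (\<exists>u \<in> neighbours G v. f u \<ge> 2)) \<and>
     \<not> (\<exists>v. isolated (G \<restriction> {u \<in> verts G. f u = 0}) v)"

definition weight :: "('a, 'b) pre_digraph \<Rightarrow> ('a \<Rightarrow> nat) \<Rightarrow> nat" where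
  "weight G f = (\<Sum>v \<in> verts G. f v)"

definition gamma_rdR :: "('a, 'b) pre_digraph \<Rightarrow> nat" where
  "gamma_rdR G = (LEAST w. \<exists>f. rdrd_function G f \<and> weight G f = w)"

text \<open>The minimum is attained, since the constant labelling \<open>2\<close> is always admissible.\<close>

lemma gamma_rdR_attained: "\<exists>f. rdrd_function G f \<and> weight G f = gamma_rdR G"
proof -
  have "rdrd_function G (\<lambda>_. 2)"
    by (auto simp: rdrd_function_def isolated_def)
  then have "\<exists>w f. rdrd_function G f \<and> weight G f = w" by blast
  then show ?thesis unfolding gamma_rdR_def by (rule LeastI_ex)
qed

lemma gamma_rdR_le: "rdrd_function G f \<Longrightarrow> gamma_rdR G \<le> weight G f"
  unfolding gamma_rdR_def by (rule Least_le) blast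

text \<open>The cycle \<open>C\<^sub>n\<close> is meant for \<open>n \<ge> 3\<close>; smaller \<open>n\<close> do not give a cycle.\<close>

definition cycle_graph :: "nat \<Rightarrow> nat pair_pre_digraph" where
  "cycle_graph n =
     \<lparr> pverts = {0..<n},
       parcs = {(i, j). i < n \<and> j < n \<and> (j = (i + 1) mod n \<or> i = (j + 1) mod n)} \<rparr>"

definition direct_product ::
  "'a pair_pre_digraph \<Rightarrow> 'b pair_pre_digraph \<Rightarrow> ('a \<times> 'b) pair_pre_digraph" where
  "direct_product G H =
     \<lparr> pverts = pverts G \<times> pverts H,
       parcs = {((u, v), (u', v')) | u v u' v'. (u, u') \<in> parcs G \<and> (v, v') \<in> parcs H} \<rparr>"

lemma pair_graph_cycle_graph:
  assumes "n \<ge> 3"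
  shows "pair_graph (cycle_graph n)"
proof
  have "parcs (cycle_graph n) \<subseteq> {0..<n} \<times> {0..<n}"
    by (auto simp: cycle_graph_def)
  then show "finite (parcs (cycle_graph n))"
    by (rule finite_subset) simp
  have *: "Suc i mod n \<noteq> i" if "i < n" for i
    using that assms by (cases "Suc i = n") auto
  show "fst e \<noteq> snd e" if "e \<in> parcs (cycle_graph n)" for e
    using that by (auto simp: cycle_graph_def dest: * *[THEN not_sym])
qed (auto simp: cycle_graph_def symmetric_def intro!: symI)

lemma pair_graph_direct_product:
  assumes "pair_graph G" "pair_graph H"
  shows "pair_graph (direct_product G H)"
proof -
  interpret G: pair_graph G by fact
  interpret H: pair_graph H by fact
  show ?thesis
  proof
    have "parcs (direct_product G H) \<subseteq> (pverts G \<times> pverts H) \<times> (pverts G \<times> pverts H)"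
      by (auto simp: direct_product_def dest: G.wellformed' H.wellformed')
    then show "finite (parcs (direct_product G H))"
      by (rule finite_subset) simp
    show "fst e \<noteq> snd e" if "e \<in> parcs (direct_product G H)" for e
      using that by (auto simp: direct_product_def dest: G.pair_no_loops)
    show "symmetric (with_proj (direct_product G H))"
      using G.sym_arcs H.sym_arcs
      by (auto simp: direct_product_def symmetric_def intro!: symI dest: symD)
  qed (auto simp: direct_product_def dest: G.wellformed' H.wellformed')
qed

end

theory Submission
  imports Defs
begin

text \<open>
  Write the labelling as a cyclic sequence of \<open>m\<close> columns, each a labelling of the triangle. The
  labelling with one constant row \<open>2\<close> and two rows \<open>0\<close> has weight \<open>2 * m\<close>
  (\<open>rdrd_function_row\<close>), so the content is that columns have weight \<open>2\<close> on average.

  Let a label \<open>x\<close> defend each neighbour with strength \<open>x - 1\<close> (truncated). Then the own label of a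
  vertex and the strength it receives add up to at least \<open>2\<close>
  (\<open>rdrd_function_defended\<close>). Strength \<open>2\<close> costs weight at least \<open>3\<close>, and a label is seen from two
  rows of the adjacent columns, so for a column \<open>b\<close> between \<open>a\<close> and \<open>c\<close> this bounds the weight of
  \<open>a\<close> and \<open>c\<close> from below in terms of the weight of \<open>b\<close>. The outcome is that \<open>a\<close>, \<open>b\<close>, \<open>c\<close> weigh at
  least \<open>6\<close> together, which would finish the proof by summation, with one kind of exception: \<open>b\<close> has
  weight \<open>2\<close>, one of its neighbours is empty and the other has weight \<open>3\<close>, as in the columns
  \<open>(3,0,0), (2,0,0), (0,0,0)\<close>.

  The exceptions disappear by discharging. The empty column pays the missing unit. Being defended
  by a column of weight \<open>2\<close> on one side, it forces weight at least \<open>4\<close> on the other; if this is more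
  than \<open>4\<close> it has a unit to spare, and if it is exactly \<open>4\<close> then that column contains a \<open>0\<close>, which
  forces yet another heavy column behind it, so that it can refund the unit. These
  payments are antisymmetric in the two columns and cancel in the cyclic sum
  (\<open>discharged_weight\<close>, \<open>weight_ge\<close>).
\<close>

section \<open>Neighbourhoods in the product of a triangle and a cycle\<close>

abbreviation C3_times_C :: "nat \<Rightarrow> (nat \<times> nat, (nat \<times> nat) \<times> (nat \<times> nat)) pre_digraph" where
  "C3_times_C m \<equiv> with_proj (direct_product (cycle_graph 3) (cycle_graph m))"

definition next_col :: "nat \<Rightarrow> nat \<Rightarrow> nat" where
  "next_col m j = (j + 1) mod m"

lemma next_col_less: "j < m \<Longrightarrow> next_col m j < m"
  by (simp add: next_col_def)

lemma next_col_if: "j < m \<Longrightarrow> next_col m j = (if Suc j = m then 0 else Suc j)"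
  by (simp add: next_col_def)

lemma inj_on_next_col: "inj_on (next_col m) {..<m}"
  by (auto simp: inj_on_def next_col_if split: if_splits)

lemma bij_betw_next_col: "bij_betw (next_col m) {..<m} {..<m}"
  unfolding bij_betw_def
  by (intro conjI inj_on_next_col endo_inj_surj) (auto intro: next_col_less inj_on_next_col)

lemma sum_next_col: "(\<Sum>j<m. g (next_col m j)) = (\<Sum>j<m. g j)"
  by (rule sum.reindex_bij_betw[OF bij_betw_next_col])

lemma next_col_next_col_neq:
  assumes "m \<ge> 3" "j < m"
  shows "next_col m (next_col m j) \<noteq> j"
  using assms by (auto simp: next_col_if next_col_less split: if_splits)

lemma pverts_C3_times_C:
  "pverts (direct_product (cycle_graph 3) (cycle_graph m)) = {..<3} \<times> {..<m}"
  by (auto simp: direct_product_def cycle_graph_def)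

lemma direct_product_arcs:
  "((u, v), (u', v')) \<in> parcs (direct_product G H) \<longleftrightarrow> (u, u') \<in> parcs G \<and> (v, v') \<in> parcs H"
  by (simp add: direct_product_def)

lemma triangle_arcs: "(i, k) \<in> parcs (cycle_graph 3) \<longleftrightarrow> i < 3 \<and> k < 3 \<and> i \<noteq> k"
proof (cases "i < 3 \<and> k < 3")
  case True
  then have "i \<in> {0, 1, 2}" "k \<in> {0, 1, 2}" by auto
  then show ?thesis by (elim insertE emptyE; hypsubst; simp add: cycle_graph_def)
next
  case False
  then show ?thesis by (auto simp: cycle_graph_def)
qed

lemma cycle_arcs_next_col:
  assumes "j < m"
  shows "(next_col m j, k) \<in> parcs (cycle_graph m)
    \<longleftrightarrow> k = j \<or> k = next_col m (next_col m j)"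
proof -
  have "(next_col m j, k) \<in> parcs (cycle_graph m) \<longleftrightarrow>
      next_col m j < m \<and> k < m \<and> (k = next_col m (next_col m j) \<or> next_col m j = next_col m k)"
    by (simp add: cycle_graph_def next_col_def)
  moreover have "next_col m j = next_col m k \<longleftrightarrow> k = j" if "k < m"
    using inj_on_next_col[of m] assms that by (auto simp: inj_on_def)
  ultimately show ?thesis using next_col_less[of _ m] assms by blast
qed

text \<open>Every column is \<open>next_col m j\<close> for exactly one \<open>j\<close>; centring neighbourhoods there avoids
  a predecessor function.\<close>

lemma neighbours_C3_times_C:
  assumes "i < 3" "j < m"
  shows "neighbours (C3_times_C m) (i, next_col m j)
    = ({..<3} - {i}) \<times> {j, next_col m (next_col m j)}"
  using assms
  by (auto simp: neighbours_def pverts_C3_times_C direct_product_arcs triangle_arcs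
      cycle_arcs_next_col next_col_less)

section \<open>The upper bound\<close>

text \<open>One row of the product labelled \<open>2\<close>: a vertex outside it sees the row once in each of
  the two adjacent columns, and it sees the remaining row, labelled \<open>0\<close>, there as well.\<close>

lemma rdrd_function_row:
  assumes m: "m \<ge> 3"
  shows "rdrd_function (C3_times_C m) (\<lambda>(i, j). if i = 0 then 2 else 0)"
    (is "rdrd_function ?G ?f")
proof -
  have two: "card {u \<in> neighbours ?G v. ?f u = 2} \<ge> 2"
    and free: "\<exists>u \<in> neighbours ?G v. ?f u = 0"
    if v: "v \<in> verts ?G" "?f v = 0" for v
  proof -
    obtain i k where ik: "v = (i, k)" "i < 3" "i \<noteq> 0" "k < m"
      using v by (auto simp: pverts_C3_times_C split: if_splits)
    then obtain j where j: "j < m" "k = next_col m j"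
      using bij_betw_next_col[of m] by (auto simp: bij_betw_def)
    have "{u \<in> neighbours ?G v. ?f u = 2} = {0} \<times> {j, next_col m (next_col m j)}"
      using ik j by (auto simp: neighbours_C3_times_C split: if_splits)
    then show "card {u \<in> neighbours ?G v. ?f u = 2} \<ge> 2"
      using next_col_next_col_neq[OF m j(1)] by (auto simp: card_insert_if)
    have "3 - i < 3" "3 - i \<noteq> i" using ik by presburger+
    then have "(3 - i, j) \<in> neighbours ?G v"
      using ik j by (simp add: neighbours_C3_times_C)
    moreover have "?f (3 - i, j) = 0" using ik by simp
    ultimately show "\<exists>u \<in> neighbours ?G v. ?f u = 0" by blast
  qed
  have "\<not> isolated (?G \<restriction> {u \<in> verts ?G. ?f u = 0}) v" for v
  proof
    assume iso: "isolated (?G \<restriction> {u \<in> verts ?G. ?f u = 0}) v"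
    then have v: "v \<in> verts ?G" "?f v = 0"
      by (auto simp: isolated_def)
    then obtain u where "u \<in> neighbours ?G v" "?f u = 0"
      using free by blast
    with v have "u \<in> neighbours (?G \<restriction> {u \<in> verts ?G. ?f u = 0}) v"
      by (auto simp: neighbours_def arcs_ends_def arc_to_ends_def)
    with iso show False by (auto simp: isolated_def)
  qed
  then show ?thesis
    using two unfolding rdrd_function_def by (auto split: if_splits)
qed

lemma weight_row:
  "weight (C3_times_C m) (\<lambda>(i, j). if i = 0 then 2 else 0) = 2 * m"
proof -
  have "{..<3} = {0, 1, 2 :: nat}" by auto
  then show ?thesis
    unfolding weight_def with_proj_simps pverts_C3_times_C
    by (simp add: sum.cartesian_product[symmetric])
qed

section \<open>The lower bound\<close>

text \<open>One linear inequality covers the conditions on the labels \<open>0\<close> and \<open>1\<close>: two neighbours \<open>2\<close> or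
  one neighbour \<open>3\<close> both amount to strength \<open>2\<close>, and any neighbour above \<open>1\<close> has strength at
  least \<open>1\<close>.\<close>

lemma rdrd_function_defended:
  assumes f: "rdrd_function G f" and v: "v \<in> verts G" and fin: "finite (neighbours G v)"
  shows "f v + (\<Sum>u \<in> neighbours G v. f u - 1) \<ge> 2"
proof -
  let ?N = "neighbours G v"
  have single: "f u - 1 \<le> (\<Sum>u \<in> ?N. f u - 1)" if "u \<in> ?N" for u
    using member_le_sum[of u ?N "\<lambda>u. f u - 1"] that fin by simp
  have twos: "card {u \<in> ?N. f u = 2} \<le> (\<Sum>u \<in> ?N. f u - 1)"
  proof -
    have "card {u \<in> ?N. f u = 2} = (\<Sum>u \<in> {u \<in> ?N. f u = 2}. f u - 1)" by simp
    also have "\<dots> \<le> (\<Sum>u \<in> ?N. f u - 1)" using fin by (intro sum_mono2) auto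
    finally show ?thesis .
  qed
  consider "f v = 0" | "f v = 1" | "f v \<ge> 2" by linarith
  then show ?thesis
  proof cases
    case 1
    then consider "card {u \<in> ?N. f u = 2} \<ge> 2" | u where "u \<in> ?N" "f u = 3"
      using f v unfolding rdrd_function_def by blast
    then show ?thesis
    proof cases
      case 1
      then show ?thesis using twos by linarith
    next
      case (2 u)
      then show ?thesis using single[of u] by simp
    qed
  next
    case 2
    then obtain u where "u \<in> ?N" "f u \<ge> 2"
      using f v unfolding rdrd_function_def by blast
    then show ?thesis using single[of u] 2 by linarith
  qed simp
qed

text \<open>A column is a function of the row \<open>0\<close>, \<open>1\<close> or \<open>2\<close>, that is, a labelling of the triangle.\<close>

definition col_weight :: "(nat \<Rightarrow> nat) \<Rightarrow> nat" where
  "col_weight c = c 0 + c 1 + c 2"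

definition col_strength :: "(nat \<Rightarrow> nat) \<Rightarrow> nat" where
  "col_strength c = (c 0 - 1) + (c 1 - 1) + (c 2 - 1)"

definition row_strength :: "(nat \<Rightarrow> nat) \<Rightarrow> (nat \<Rightarrow> nat) \<Rightarrow> nat \<Rightarrow> nat" where
  "row_strength a c k = (a k - 1) + (c k - 1)"

text \<open>The column \<open>b\<close> between the columns \<open>a\<close> and \<open>c\<close>: a vertex in row \<open>i\<close> has its four neighbours
  in the other two rows of \<open>a\<close> and \<open>c\<close>.\<close>

definition defended_between :: "(nat \<Rightarrow> nat) \<Rightarrow> (nat \<Rightarrow> nat) \<Rightarrow> (nat \<Rightarrow> nat) \<Rightarrow> bool" where
  "defended_between a b c \<longleftrightarrow>
     (\<forall>i<3. a i \<le> 3 \<and> b i \<le> 3 \<and> c i \<le> 3) \<and>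
     (\<forall>i<3. b i + (\<Sum>k \<in> {..<3} - {i}. row_strength a c k) \<ge> 2)"

lemma defended_between_commute: "defended_between a b c \<longleftrightarrow> defended_between c b a"
  by (auto simp: defended_between_def row_strength_def add.commute)

lemma col_strength_rows:
  "col_strength a + col_strength c = row_strength a c 0 + row_strength a c 1 + row_strength a c 2"
  by (simp only: col_strength_def row_strength_def add_ac)

text \<open>The cheapest label per unit of strength is \<open>3\<close>, which buys strength \<open>2\<close>.\<close>

lemma col_weight_strength:
  assumes "\<forall>i<3. c i \<le> 3"
  shows "2 * col_weight c \<ge> 3 * col_strength c"
proof -
  have label: "2 * x \<ge> 3 * (x - 1)" if "x \<le> 3" for x :: nat
    using that by linarith
  have "c 0 \<le> 3" "c 1 \<le> 3" "c 2 \<le> 3" using assms by auto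
  then show ?thesis
    using label[of "c 0"] label[of "c 1"] label[of "c 2"]
    unfolding col_weight_def col_strength_def distrib_left by linarith
qed

lemma defended_between_strength:
  assumes "defended_between a b c" "i < 3"
  shows "col_strength a + col_strength c + b i \<ge> 2 + row_strength a c i"
proof -
  have "col_strength a + col_strength c = (\<Sum>k<3. row_strength a c k)"
    unfolding col_strength_rows by (simp add: eval_nat_numeral)
  also have "\<dots> = row_strength a c i + (\<Sum>k \<in> {..<3} - {i}. row_strength a c k)"
    using assms(2) by (subst sum.remove[of _ i]) auto
  finally show ?thesis
    using assms unfolding defended_between_def by fastforce
qed

text \<open>Adding the three demands of a column counts the strength of every label next to it twice,
  since a label is seen from the two other rows.\<close>

lemma defended_between_total:
  assumes "defended_between a b c"
  shows "2 * col_strength a + 2 * col_strength c + col_weight b \<ge> 6"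
  using defended_between_strength[OF assms, of 0] defended_between_strength[OF assms, of 1]
    defended_between_strength[OF assms, of 2]
    col_strength_rows[of a c]
  unfolding col_weight_def by linarith

lemma defended_between_weight_strength:
  assumes "defended_between a b c"
  shows "2 * col_weight a \<ge> 3 * col_strength a" "2 * col_weight c \<ge> 3 * col_strength c"
  using assms by (auto simp: defended_between_def intro!: col_weight_strength)

text \<open>The averaged bound gives only \<open>5\<close> here. Equality would need total strength \<open>3\<close>, but then
  no row can hold more than \<open>1\<close> of it, so the strength sits in three separate labels \<open>2\<close>.\<close>

lemma weight_around_zero_col:
  assumes d: "defended_between a b c" and b: "col_weight b = 0"
  shows "col_weight a + col_weight c \<ge> 6"
proof (cases "col_strength a + col_strength c \<ge> 4")
  case True
  then show ?thesis using defended_between_weight_strength[OF d] by linarith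
next
  case False
  let ?s = "row_strength a c"
  have "b 0 = 0" "b 1 = 0" "b 2 = 0" using b by (auto simp: col_weight_def)
  then have "?s 0 = 1" "?s 1 = 1" "?s 2 = 1"
    using defended_between_strength[OF d, of 0] defended_between_strength[OF d, of 1]
      defended_between_strength[OF d, of 2] False col_strength_rows[of a c] by linarith+
  moreover have "a k + c k \<ge> 2" if "?s k = 1" for k
    using that unfolding row_strength_def by linarith
  ultimately have "a 0 + c 0 \<ge> 2" "a 1 + c 1 \<ge> 2" "a 2 + c 2 \<ge> 2" by blast+
  then show ?thesis unfolding col_weight_def by linarith
qed

text \<open>The adjacent strength \<open>2\<close> costs only \<open>3\<close> when it is a single label \<open>3\<close>, which leaves the other
  side empty; strength from both sides costs at least \<open>2\<close> on each.\<close>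

lemma weight_around_two_col:
  assumes d: "defended_between a b c" and b: "col_weight b = 2"
  shows "col_weight a + col_weight c \<ge> 4
    \<or> col_weight a + col_weight c = 3 \<and> (col_weight a = 0 \<or> col_weight c = 0)"
proof -
  have "col_strength a + col_strength c \<ge> 2"
    using defended_between_total[OF d] b by linarith
  then consider "col_strength a \<ge> 2" | "col_strength c \<ge> 2"
    | "col_strength a \<ge> 1" "col_strength c \<ge> 1"
    by linarith
  then show ?thesis
  proof cases
    case 1
    then have "col_weight a \<ge> 3" using defended_between_weight_strength[OF d] by linarith
    then show ?thesis by auto
  next
    case 2
    then have "col_weight c \<ge> 3" using defended_between_weight_strength[OF d] by linarith
    then show ?thesis by auto
  next
    case 3
    then have "col_weight a \<ge> 2" "col_weight c \<ge> 2"
      using defended_between_weight_strength[OF d] by linarith+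
    then show ?thesis by linarith
  qed
qed

text \<open>Weight \<open>4\<close> without a zero means the labels \<open>2, 1, 1\<close>, hence strength \<open>1\<close>; a column of
  weight \<open>2\<close> has strength at most \<open>1\<close> too, and the empty column needs strength \<open>3\<close>.\<close>

lemma weight_four_col_beyond_zero_col:
  assumes d: "defended_between a b c" and "col_weight b = 0" "col_weight a = 2" "col_weight c = 4"
  shows "c 0 = 0 \<or> c 1 = 0 \<or> c 2 = 0"
proof -
  have "col_strength a \<le> 1"
    using defended_between_weight_strength[OF d] assms by linarith
  moreover have "col_strength a + col_strength c \<ge> 3"
    using defended_between_total[OF d] assms by linarith
  moreover have "col_strength c + 3 = col_weight c" if "c 0 \<noteq> 0" "c 1 \<noteq> 0" "c 2 \<noteq> 0"
    using that
    by (cases "c 0"; cases "c 1"; cases "c 2") (simp_all add: col_strength_def col_weight_def)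
  ultimately show ?thesis using assms(4) by fastforce
qed

text \<open>The amount a column collects from each empty neighbour, negative if it pays.\<close>

definition bonus :: "(nat \<Rightarrow> nat) \<Rightarrow> int" where
  "bonus c = (if col_weight c = 2 then 1
     else if col_weight c = 4 \<and> (c 0 = 0 \<or> c 1 = 0 \<or> c 2 = 0) then - 1 else 0)"

text \<open>What column \<open>c\<close> receives from its neighbour \<open>d\<close>. Only empty columns trade: they pay one
  unit to a neighbour of weight \<open>2\<close> and collect one from a neighbour of weight \<open>4\<close> with a zero.\<close>

definition transfer :: "(nat \<Rightarrow> nat) \<Rightarrow> (nat \<Rightarrow> nat) \<Rightarrow> int" where
  "transfer c d =
     (if col_weight d = 0 then bonus c else 0) - (if col_weight c = 0 then bonus d else 0)"

lemma transfer_antisym: "transfer d c = - transfer c d"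
  by (simp add: transfer_def)

text \<open>Three kinds of column take part in transfers. A column of weight \<open>2\<close> is repaired by its empty
  neighbour. A column of weight \<open>4\<close> with a zero can pay because that zero needs weight \<open>3\<close> outside,
  which also rules out two empty neighbours. An empty column that pays a neighbour of weight \<open>2\<close>
  faces weight at least \<open>4\<close> on the other side, and is either refunded by it or left with a surplus.
  For the other columns, rounding up the strength and then its cost already gives \<open>6\<close>.\<close>

lemma discharged_weight:
  assumes d: "defended_between a b c"
  shows "int (col_weight a + col_weight b + col_weight c) + transfer b a + transfer b c \<ge> 6"
proof -
  note tot = defended_between_total[OF d] and ws = defended_between_weight_strength[OF d]
  consider "col_weight b = 0" | "col_weight b = 2"
    | "col_weight b = 4" "b 0 = 0 \<or> b 1 = 0 \<or> b 2 = 0"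
    | "col_weight b \<noteq> 0" "col_weight b \<noteq> 2"
      "\<not> (col_weight b = 4 \<and> (b 0 = 0 \<or> b 1 = 0 \<or> b 2 = 0))"
    by metis
  then show ?thesis
  proof cases
    case 1
    have six: "col_weight a + col_weight c \<ge> 6" by (rule weight_around_zero_col[OF d 1])
    have b0: "bonus b = 0" using 1 by (simp add: bonus_def)
    have le: "bonus x \<le> 0" if "col_weight x \<noteq> 2" for x
      using that by (simp add: bonus_def)
    have share: "bonus x + bonus y \<le> int (col_weight x + col_weight y) - 6"
      if xy: "defended_between x b y" "col_weight x = 2" for x y
    proof -
      have y: "col_weight y \<ge> 4" using weight_around_zero_col[OF xy(1) 1] xy(2) by linarith
      show ?thesis
      proof (cases "col_weight y = 4")
        case True
        then show ?thesis
          using weight_four_col_beyond_zero_col[OF xy(1) 1 xy(2)] xy(2) by (simp add: bonus_def)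
      next
        case False
        then show ?thesis using y xy(2) by (simp add: bonus_def)
      qed
    qed
    have "bonus a + bonus c \<le> int (col_weight a + col_weight c) - 6"
    proof -
      consider "col_weight a = 2" | "col_weight c = 2" | "col_weight a \<noteq> 2" "col_weight c \<noteq> 2"
        by blast
      then show ?thesis
      proof cases
        case 1
        then show ?thesis using share[OF d] by simp
      next
        case 2
        then show ?thesis
          using share[OF d[unfolded defended_between_commute[of a]]] by simp
      next
        case 3
        then show ?thesis using le[of a] le[of c] six by linarith
      qed
    qed
    then show ?thesis using 1 b0 by (simp add: transfer_def)
  next
    case 2
    then show ?thesis
      using weight_around_two_col[OF d 2] by (auto simp: transfer_def bonus_def)
  next
    case 3
    have "\<exists>i<3. b i = 0"
      using 3(2) by (elim disjE) (rule exI[of _ 0] exI[of _ 1] exI[of _ 2], simp)+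
    then obtain i where "i < 3" "b i = 0" by blast
    then have "col_strength a + col_strength c \<ge> 2"
      using defended_between_strength[OF d, of i] by linarith
    then have "col_weight a + col_weight c \<ge> 3" using ws by linarith
    then show ?thesis using 3(1) by (auto simp: transfer_def bonus_def)
  next
    case 4
    let ?S = "col_strength a + col_strength c"
    have "col_weight a + col_weight b + col_weight c \<ge> 6"
    proof -
      consider "col_weight b = 1" | "col_weight b = 3" | "col_weight b = 4 \<or> col_weight b = 5"
        | "col_weight b \<ge> 6"
        using 4(1,2) by linarith
      then show ?thesis
      proof cases
        case 1
        then have "?S \<ge> 3" using tot by linarith
        then show ?thesis using 1 ws by linarith
      next
        case 2
        then have "?S \<ge> 2" using tot by linarith
        then show ?thesis using 2 ws by linarith
      next
        case 3
        then have "?S \<ge> 1" using tot by linarith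
        then show ?thesis using 3 ws by linarith
      qed linarith
    qed
    moreover have "bonus b = 0" using 4 by (auto simp: bonus_def)
    ultimately show ?thesis using 4(1) by (simp add: transfer_def)
  qed
qed

lemma weight_ge:
  assumes m: "m \<ge> 3" and f: "rdrd_function (C3_times_C m) f"
  shows "2 * m \<le> weight (C3_times_C m) f"
proof -
  define col where "col j i = f (i, j)" for j i :: nat
  let ?n = "next_col m"
  let ?w = "\<lambda>j. col_weight (col j)"
  have label: "col j i \<le> 3" if "i < 3" "j < m" for i j
  proof -
    have "f (i, j) \<in> {0, 1, 2, 3}"
      using f that unfolding rdrd_function_def by (auto simp: pverts_C3_times_C)
    then show ?thesis by (auto simp: col_def)
  qed
  have defended: "defended_between (col j) (col (?n j)) (col (?n (?n j)))" if j: "j < m" for j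
  proof -
    have "col (?n j) i + (\<Sum>k \<in> {..<3} - {i}. row_strength (col j) (col (?n (?n j))) k) \<ge> 2"
      if i: "i < 3" for i
    proof -
      have N: "neighbours (C3_times_C m) (i, ?n j) = ({..<3} - {i}) \<times> {j, ?n (?n j)}"
        by (rule neighbours_C3_times_C[OF i j])
      have "(i, ?n j) \<in> verts (C3_times_C m)"
        using i j by (simp add: pverts_C3_times_C next_col_less)
      from rdrd_function_defended[OF f this]
      have "f (i, ?n j) + (\<Sum>u \<in> ({..<3} - {i}) \<times> {j, ?n (?n j)}. f u - 1) \<ge> 2"
        unfolding N by simp
      moreover have "(\<Sum>u \<in> ({..<3} - {i}) \<times> {j, ?n (?n j)}. f u - 1)
          = (\<Sum>k \<in> {..<3} - {i}. row_strength (col j) (col (?n (?n j))) k)"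
        unfolding sum.cartesian_product'
        using next_col_next_col_neq[OF m j] by (simp add: col_def row_strength_def)
      ultimately show ?thesis by (simp add: col_def)
    qed
    then show ?thesis
      unfolding defended_between_def using label j next_col_less by blast
  qed
  have shift: "(\<Sum>j<m. ?w (?n j)) = (\<Sum>j<m. ?w j)"
    "(\<Sum>j<m. ?w (?n (?n j))) = (\<Sum>j<m. ?w j)"
    using sum_next_col[of "\<lambda>j. ?w (?n j)" m] sum_next_col[of ?w m] by simp_all
  (* By antisymmetry, what the columns receive from the left is minus what the columns one step
     earlier receive from the right. *)
  have balance: "(\<Sum>j<m. transfer (col (?n j)) (col j))
      = - (\<Sum>j<m. transfer (col (?n j)) (col (?n (?n j))))"
  proof -
    have "(\<Sum>j<m. transfer (col (?n j)) (col j)) = - (\<Sum>j<m. transfer (col j) (col (?n j)))"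
      unfolding sum_negf[symmetric] by (intro sum.cong refl transfer_antisym)
    then show ?thesis
      using sum_next_col[of "\<lambda>j. transfer (col j) (col (?n j))" m] by simp
  qed
  (* Each column lies in three of the windows j, j + 1, j + 2. *)
  have "6 * int m = (\<Sum>j<m. 6)" by simp
  also have "\<dots> \<le> (\<Sum>j<m. int (?w j + ?w (?n j) + ?w (?n (?n j)))
      + transfer (col (?n j)) (col j) + transfer (col (?n j)) (col (?n (?n j))))"
    using discharged_weight[OF defended] by (intro sum_mono) auto
  also have "\<dots> = int (\<Sum>j<m. ?w j + ?w (?n j) + ?w (?n (?n j)))"
    by (simp add: sum.distrib balance)
  also have "\<dots> = 3 * int (\<Sum>j<m. ?w j)"
    by (simp add: sum.distrib shift)
  finally have "2 * m \<le> (\<Sum>j<m. ?w j)" by linarith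
  also have "(\<Sum>j<m. ?w j) = (\<Sum>j<m. \<Sum>i<3. f (i, j))"
    by (simp add: col_weight_def col_def eval_nat_numeral)
  also have "\<dots> = weight (C3_times_C m) f"
    unfolding weight_def with_proj_simps pverts_C3_times_C
    by (subst sum.swap) (simp add: sum.cartesian_product)
  finally show ?thesis .
qed

theorem theorem4p7:
  fixes m :: nat
  assumes "m \<ge> 3"
  shows "gamma_rdR (with_proj (direct_product (cycle_graph 3) (cycle_graph m))) = 2 * m"
proof (rule antisym)
  show "gamma_rdR (C3_times_C m) \<le> 2 * m"
    using gamma_rdR_le[OF rdrd_function_row[OF assms]] by (simp add: weight_row)
  show "2 * m \<le> gamma_rdR (C3_times_C m)"
    using gamma_rdR_attained[of "C3_times_C m"] weight_ge[OF assms] by force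
qed

end
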